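(* The set of pairs $(R,t)$ with $R$ a finite TRS and $t$ a term such that $R$ is confluent on $t$ is $\Pi^0_2$-complete; and the set of pairs $(R,t)$ with $t$ a ground term such that $R$ is confluent on $t$ is $\Pi^0_2$-complete.
   Context: All TRSs are finite sets of rules over a finite signature; terms may contain variables, ground terms contain none. A TRS $R$ is confluent on a term $t$ if for all terms $t_1,t_2$ with $t_1 \leftarrow_R^* t\to_R^* t_2$ there is a term $d$ with $t_1\to_R^* d\leftarrow_R^* t_2$. TRSs and terms are encoded as natural numbers by a standard effective Gödel numbering, and properties are identified with the corresponding sets of codes. $\Sigma^0_n,\Pi^0_n$ are the classes of the arithmetical hierarchy; a set $B$ is $\mathcal P$-complete if $B\in\mathcal P$ and every $A\in\mathcal P$ is many-one reducible to $B$ via a total computable function. *)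

theory Defs
  imports Main "HOL-Library.Nat_Bijection"
begin

datatype recf = Zero | Succ | Proj nat | Comp recf "recf list" | Prec recf recf | Minim recf

inductive recf_eval :: "recf \<Rightarrow> nat list \<Rightarrow> nat \<Rightarrow> bool" where
  ev_zero: "recf_eval Zero xs 0"
| ev_succ: "recf_eval Succ (x # xs) (Suc x)"
| ev_proj: "n < length xs \<Longrightarrow> recf_eval (Proj n) xs (xs ! n)"
| ev_comp: "length ys = length fs \<Longrightarrow> (\<forall>i<length fs. recf_eval (fs ! i) xs (ys ! i))
            \<Longrightarrow> recf_eval g ys y \<Longrightarrow> recf_eval (Comp g fs) xs y"
| ev_prec0: "recf_eval f xs y \<Longrightarrow> recf_eval (Prec f g) (0 # xs) y"
| ev_precS: "recf_eval (Prec f g) (n # xs) y \<Longrightarrow> recf_eval g (n # y # xs) z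
            \<Longrightarrow> recf_eval (Prec f g) (Suc n # xs) z"
| ev_minim: "recf_eval f (n # xs) 0 \<Longrightarrow> (\<forall>m<n. \<exists>k. recf_eval f (m # xs) (Suc k))
            \<Longrightarrow> recf_eval (Minim f) xs n"

definition total_computable :: "(nat \<Rightarrow> nat) \<Rightarrow> bool" where
  "total_computable f \<longleftrightarrow> (\<exists>p. \<forall>x. recf_eval p [x] (f x))"

definition decidable3 :: "(nat \<Rightarrow> nat \<Rightarrow> nat \<Rightarrow> bool) \<Rightarrow> bool" where
  "decidable3 P \<longleftrightarrow> (\<exists>p. \<forall>x y z. recf_eval p [x, y, z] (if P x y z then 1 else 0))"

definition Pi02 :: "nat set \<Rightarrow> bool" where
  "Pi02 A \<longleftrightarrow> (\<exists>P. decidable3 P \<and> (\<forall>x. x \<in> A \<longleftrightarrow> (\<forall>y. \<exists>z. P x y z)))"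

definition many_one_reducible :: "nat set \<Rightarrow> nat set \<Rightarrow> bool" where
  "many_one_reducible A B \<longleftrightarrow> (\<exists>f. total_computable f \<and> (\<forall>x. x \<in> A \<longleftrightarrow> f x \<in> B))"

definition Pi02_complete :: "nat set \<Rightarrow> bool" where
  "Pi02_complete B \<longleftrightarrow> Pi02 B \<and> (\<forall>A. Pi02 A \<longrightarrow> many_one_reducible A B)"

text \<open>Function symbols are nats; a symbol is identified together with its arity
  (the length of its argument list). Variables are nats.\<close>
datatype trm = Var nat | Fun nat "trm list"

fun vars :: "trm \<Rightarrow> nat set" where
  "vars (Var x) = {x}"
| "vars (Fun f ts) = (\<Union>t\<in>set ts. vars t)"

definition ground :: "trm \<Rightarrow> bool" where
  "ground t \<longleftrightarrow> vars t = {}"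

fun subst :: "(nat \<Rightarrow> trm) \<Rightarrow> trm \<Rightarrow> trm" where
  "subst \<sigma> (Var x) = \<sigma> x"
| "subst \<sigma> (Fun f ts) = Fun f (map (subst \<sigma>) ts)"

type_synonym rule = "trm \<times> trm"

definition is_trs :: "rule list \<Rightarrow> bool" where
  "is_trs R \<longleftrightarrow> (\<forall>(l, r)\<in>set R. (\<forall>x. l \<noteq> Var x) \<and> vars r \<subseteq> vars l)"

inductive rstep :: "rule list \<Rightarrow> trm \<Rightarrow> trm \<Rightarrow> bool" for R where
  root: "(l, r) \<in> set R \<Longrightarrow> rstep R (subst \<sigma> l) (subst \<sigma> r)"
| ctxt: "rstep R s t \<Longrightarrow> i < length ss \<Longrightarrow> rstep R (Fun f (ss[i := s])) (Fun f (ss[i := t]))"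

definition confluent_on :: "rule list \<Rightarrow> trm \<Rightarrow> bool" where
  "confluent_on R t \<longleftrightarrow> (\<forall>t1 t2. (rstep R)\<^sup>*\<^sup>* t t1 \<longrightarrow> (rstep R)\<^sup>*\<^sup>* t t2 \<longrightarrow>
      (\<exists>d. (rstep R)\<^sup>*\<^sup>* t1 d \<and> (rstep R)\<^sup>*\<^sup>* t2 d))"

fun enc_term :: "trm \<Rightarrow> nat" where
  "enc_term (Var x) = prod_encode (0, x)"
| "enc_term (Fun f ts) = prod_encode (Suc f, list_encode (map enc_term ts))"

definition enc_rule :: "rule \<Rightarrow> nat" where
  "enc_rule lr = prod_encode (enc_term (fst lr), enc_term (snd lr))"

definition enc_trs :: "rule list \<Rightarrow> nat" where
  "enc_trs R = list_encode (map enc_rule R)"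

definition enc_pair :: "rule list \<Rightarrow> trm \<Rightarrow> nat" where
  "enc_pair R t = prod_encode (enc_trs R, enc_term t)"

definition CONF :: "nat set" where
  "CONF = {enc_pair R t | R t. is_trs R \<and> confluent_on R t}"

definition GCONF :: "nat set" where
  "GCONF = {enc_pair R t | R t. is_trs R \<and> ground t \<and> confluent_on R t}"

end

theory Submission
  imports Defs
begin

text \<open>Membership: all codings are bijections, so every number is a pair \<open>(R, t)\<close>. Rewriting is turned
  into a computable function that applies a list of choices to a term; then \<open>R\<close> is confluent on \<open>t\<close>
  iff for any two choice lists there are two further ones that lead to a common term.

  Hardness: a single rewriting system interprets recursive functions given as terms, by an abstract
  machine with continuations. The start term \<open>Guess p x 0\<close> may count up to any \<open>y\<close>, jump to the
  normal form \<open>tTrue\<close>, or start a deterministic search for some \<open>z\<close> with \<open>P x y z\<close> that ends in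
  \<open>tTrue\<close> iff it succeeds. As \<open>tTrue\<close> is always reachable from the start term, confluence on it
  says that every reduct reaches \<open>tTrue\<close>, that is, that each search succeeds.\<close>

section \<open>Total computable functions\<close>

named_theorems tc_intros

lemma eval_Comp1:
  "recf_eval f xs a \<Longrightarrow> recf_eval g [a] y \<Longrightarrow> recf_eval (Comp g [f]) xs y"
  by (rule ev_comp[where ys = "[a]"]) auto

lemma eval_Comp2:
  "recf_eval f1 xs a \<Longrightarrow> recf_eval f2 xs b \<Longrightarrow> recf_eval g [a, b] y
    \<Longrightarrow> recf_eval (Comp g [f1, f2]) xs y"
  by (rule ev_comp[where ys = "[a, b]"]) (auto simp: less_Suc_eq)

lemma eval_Proj0: "recf_eval (Proj 0) (a # xs) a"
  using ev_proj[of 0 "a # xs"] by simp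

lemma eval_Proj1: "recf_eval (Proj (Suc 0)) (a # b # xs) b"
  using ev_proj[of "Suc 0" "a # b # xs"] by simp

lemma eval_Proj2: "recf_eval (Proj (Suc (Suc 0))) (a # b # c # xs) c"
  using ev_proj[of "Suc (Suc 0)" "a # b # c # xs"] by simp

text \<open>Primitive recursion with one parameter turns a ternary step function into a binary
  function. These arities suffice to construct pairing; afterwards several arguments are packed into
  one number.\<close>

definition total_computable2 :: "(nat \<Rightarrow> nat \<Rightarrow> nat) \<Rightarrow> bool" where
  "total_computable2 g \<longleftrightarrow> (\<exists>p. \<forall>x y. recf_eval p [x, y] (g x y))"

definition total_computable3 :: "(nat \<Rightarrow> nat \<Rightarrow> nat \<Rightarrow> nat) \<Rightarrow> bool" where
  "total_computable3 g \<longleftrightarrow> (\<exists>p. \<forall>x y z. recf_eval p [x, y, z] (g x y z))"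

lemma tc_id [tc_intros]: "total_computable (\<lambda>x. x)"
  unfolding total_computable_def by (blast intro: eval_Proj0)

lemma tc_const [tc_intros]: "total_computable (\<lambda>x. c)"
  unfolding total_computable_def
proof (induction c)
  case 0 show ?case by (blast intro: ev_zero)
next
  case (Suc c) then show ?case by (metis eval_Comp1 ev_succ)
qed

lemma tc_app1: "total_computable g \<Longrightarrow> total_computable f \<Longrightarrow> total_computable (\<lambda>x. g (f x))"
proof -
  assume "total_computable g" "total_computable f"
  then obtain p q where "\<And>a. recf_eval p [a] (g a)" "\<And>x. recf_eval q [x] (f x)"
    unfolding total_computable_def by blast
  then have "recf_eval (Comp p [q]) [x] (g (f x))" for x
    by (rule eval_Comp1[rotated])
  then show ?thesis unfolding total_computable_def by blast
qed

lemma tc_app2: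
  "total_computable2 g \<Longrightarrow> total_computable f \<Longrightarrow> total_computable h
    \<Longrightarrow> total_computable (\<lambda>x. g (f x) (h x))"
proof -
  assume "total_computable2 g" "total_computable f" "total_computable h"
  then obtain p q r where p: "\<And>a b. recf_eval p [a, b] (g a b)"
    and q: "\<And>x. recf_eval q [x] (f x)" and r: "\<And>x. recf_eval r [x] (h x)"
    unfolding total_computable2_def total_computable_def by blast
  have "recf_eval (Comp p [q, r]) [x] (g (f x) (h x))" for x
    by (rule eval_Comp2[OF q r p])
  then show ?thesis unfolding total_computable2_def total_computable_def by blast
qed

lemma tc2_app1:
  "total_computable g \<Longrightarrow> total_computable2 f \<Longrightarrow> total_computable2 (\<lambda>x y. g (f x y))"
proof -
  assume "total_computable g" "total_computable2 f"
  then obtain p q where "\<And>a. recf_eval p [a] (g a)" "\<And>x y. recf_eval q [x, y] (f x y)"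
    unfolding total_computable2_def total_computable_def by blast
  then have "recf_eval (Comp p [q]) [x, y] (g (f x y))" for x y
    by (rule eval_Comp1[rotated])
  then show ?thesis unfolding total_computable2_def total_computable_def by blast
qed

lemma tc2_app2:
  "total_computable2 g \<Longrightarrow> total_computable2 f \<Longrightarrow> total_computable2 h
    \<Longrightarrow> total_computable2 (\<lambda>x y. g (f x y) (h x y))"
proof -
  assume "total_computable2 g" "total_computable2 f" "total_computable2 h"
  then obtain p q r where p: "\<And>a b. recf_eval p [a, b] (g a b)"
    and q: "\<And>x y. recf_eval q [x, y] (f x y)" and r: "\<And>x y. recf_eval r [x, y] (h x y)"
    unfolding total_computable2_def by blast
  have "recf_eval (Comp p [q, r]) [x, y] (g (f x y) (h x y))" for x y
    by (rule eval_Comp2[OF q r p])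
  then show ?thesis unfolding total_computable2_def by blast
qed

lemma tc3_app1:
  "total_computable g \<Longrightarrow> total_computable3 f \<Longrightarrow> total_computable3 (\<lambda>x y z. g (f x y z))"
proof -
  assume "total_computable g" "total_computable3 f"
  then obtain p q where "\<And>a. recf_eval p [a] (g a)" "\<And>x y z. recf_eval q [x, y, z] (f x y z)"
    unfolding total_computable3_def total_computable_def by blast
  then have "recf_eval (Comp p [q]) [x, y, z] (g (f x y z))" for x y z
    by (rule eval_Comp1[rotated])
  then show ?thesis unfolding total_computable3_def total_computable_def by blast
qed

lemma tc3_app2:
  "total_computable2 g \<Longrightarrow> total_computable3 f \<Longrightarrow> total_computable3 h
    \<Longrightarrow> total_computable3 (\<lambda>x y z. g (f x y z) (h x y z))"
proof -
  assume "total_computable2 g" "total_computable3 f" "total_computable3 h"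
  then obtain p q r where p: "\<And>a b. recf_eval p [a, b] (g a b)"
    and q: "\<And>x y z. recf_eval q [x, y, z] (f x y z)" and r: "\<And>x y z. recf_eval r [x, y, z] (h x y z)"
    unfolding total_computable2_def total_computable3_def by blast
  have "recf_eval (Comp p [q, r]) [x, y, z] (g (f x y z) (h x y z))" for x y z
    by (rule eval_Comp2[OF q r p])
  then show ?thesis unfolding total_computable2_def total_computable3_def by blast
qed

lemma tc2_proj: "total_computable2 (\<lambda>x y. x)" "total_computable2 (\<lambda>x y. y)"
  unfolding total_computable2_def by (blast intro: eval_Proj0 eval_Proj1)+

lemma tc3_proj:
  "total_computable3 (\<lambda>x y z. x)" "total_computable3 (\<lambda>x y z. y)" "total_computable3 (\<lambda>x y z. z)"
  unfolding total_computable3_def by (blast intro: eval_Proj0 eval_Proj1 eval_Proj2)+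

lemma tc2_rec:
  assumes "total_computable a" "total_computable3 s"
  shows "total_computable2 (\<lambda>n x. rec_nat (a x) (\<lambda>m r. s m r x) n)"
proof -
  obtain p q where p: "\<And>x. recf_eval p [x] (a x)" and q: "\<And>x y z. recf_eval q [x, y, z] (s x y z)"
    using assms unfolding total_computable_def total_computable3_def by blast
  have "recf_eval (Prec p q) [n, x] (rec_nat (a x) (\<lambda>m r. s m r x) n)" for n x
    by (induction n) (auto intro: ev_prec0 ev_precS p q)
  then show ?thesis unfolding total_computable2_def by blast
qed

lemma tc_Suc': "total_computable Suc"
  unfolding total_computable_def by (blast intro: ev_succ)

lemma tc2_plus: "total_computable2 (+)"
proof -
  have "rec_nat x (\<lambda>m r. Suc r) n = n + x" for n x by (induction n) auto
  then show ?thesis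
    using tc2_rec[OF tc_id tc3_app1[OF tc_Suc' tc3_proj(2)]] by simp
qed

lemma tc_pred: "total_computable (\<lambda>n. n - 1)"
proof -
  \<comment> \<open>The step function returns the counter instead of the previous value.\<close>
  have "recf_eval (Prec Zero (Proj 0)) [n] (n - 1)" for n
  proof (induction n)
    case 0 show ?case by (simp add: ev_prec0 ev_zero)
  next
    case (Suc n) show ?case by (rule ev_precS[OF Suc]) (simp add: eval_Proj0)
  qed
  then show ?thesis unfolding total_computable_def by blast
qed

lemma tc2_minus: "total_computable2 (-)"
proof -
  have "rec_nat x (\<lambda>m r. r - 1) n = x - n" for n x :: nat by (induction n) auto
  then have "total_computable2 (\<lambda>n x. x - n)"
    using tc2_rec[OF tc_id tc3_app1[OF tc_pred tc3_proj(2)]] by simp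
  from tc2_app2[OF this tc2_proj(2,1)] show ?thesis by simp
qed

lemma tc_triangle: "total_computable triangle"
proof -
  have eq: "rec_nat 0 (\<lambda>m r. r + Suc m) n = triangle n" for n by (induction n) auto
  have "total_computable3 (\<lambda>m r x. r + Suc m)"
    by (rule tc3_app2[OF tc2_plus tc3_proj(2) tc3_app1[OF tc_Suc' tc3_proj(1)]])
  from tc2_rec[OF tc_const[of 0] this] have "total_computable2 (\<lambda>n x. triangle n)"
    unfolding eq .
  from tc_app2[OF this tc_id tc_id] show ?thesis by simp
qed

section \<open>Cantor pairing and its projections\<close>

definition pair :: "nat \<Rightarrow> nat \<Rightarrow> nat" where "pair a b = prod_encode (a, b)"
definition pfst :: "nat \<Rightarrow> nat" where "pfst n = fst (prod_decode n)"
definition psnd :: "nat \<Rightarrow> nat" where "psnd n = snd (prod_decode n)"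

lemma pfst_pair [simp]: "pfst (pair a b) = a" and psnd_pair [simp]: "psnd (pair a b) = b"
  by (simp_all add: pair_def pfst_def psnd_def)

lemma pair_pfst_psnd [simp]: "pair (pfst n) (psnd n) = n"
  by (simp add: pair_def pfst_def psnd_def)

lemma pair_cases: obtains a b where "n = pair a b"
  by (metis pair_pfst_psnd)

lemma tc2_pair: "total_computable2 pair"
proof -
  have "total_computable2 (\<lambda>m n. triangle (m + n) + m)"
    by (rule tc2_app2[OF tc2_plus tc2_app1[OF tc_triangle tc2_app2[OF tc2_plus tc2_proj]] tc2_proj(1)])
  then show ?thesis by (simp add: pair_def[abs_def] prod_encode_def)
qed

lemma tc_pfst_plus_psnd: "total_computable (\<lambda>z. pfst z + psnd z)"
proof -
  \<comment> \<open>The sum is the index of the Cantor diagonal containing \<open>z\<close>, found by unbounded search.\<close>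
  have "total_computable2 (\<lambda>k z. Suc z - triangle (Suc k))"
    by (intro tc2_app2[OF tc2_minus] tc2_app1[OF tc_Suc'] tc2_app1[OF tc_triangle] tc2_proj)
  \<comment> \<open>The truncated difference is 0 iff \<open>z < triangle (Suc k)\<close>, so
    minimization finds the largest \<open>k\<close> with \<open>triangle k \<le> z\<close>.\<close>
  then obtain p where p: "\<And>k z. recf_eval p [k, z] (Suc z - triangle (Suc k))"
    unfolding total_computable2_def by blast
  have mono: "triangle m \<le> triangle n" if "m \<le> n" for m n
    using that by (induction n rule: dec_induct) auto
  have "recf_eval (Minim p) [z] (pfst z + psnd z)" for z
  proof -
    obtain a b where z: "z = pair a b" by (rule pair_cases)
    then have zt: "z = triangle (a + b) + a" by (simp add: pair_def prod_encode_def)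
    show ?thesis
    proof (rule ev_minim)
      show "recf_eval p [pfst z + psnd z, z] 0"
        using p[of "a + b" z] by (simp add: z) (simp add: z[symmetric] zt)
      show "\<forall>m<pfst z + psnd z. \<exists>k. recf_eval p [m, z] (Suc k)"
      proof (intro allI impI)
        fix m assume "m < pfst z + psnd z"
        then have "triangle (Suc m) \<le> z"
          using mono[of "Suc m" "a + b"] zt by (simp add: z del: triangle_Suc)
        then show "\<exists>k. recf_eval p [m, z] (Suc k)"
          using p[of m z] by (metis Suc_diff_le)
      qed
    qed
  qed
  then show ?thesis unfolding total_computable_def by blast
qed

lemma tc_pfst': "total_computable pfst"
proof -
  have "pfst z = z - triangle (pfst z + psnd z)" for z
    by (rule pair_cases[of z]) (simp, simp add: pair_def prod_encode_def)
  then show ?thesis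
    using tc_app2[OF tc2_minus tc_id tc_app1[OF tc_triangle tc_pfst_plus_psnd]] by presburger
qed

lemma tc_psnd': "total_computable psnd"
  using tc_app2[OF tc2_minus tc_pfst_plus_psnd tc_pfst'] by simp

text \<open>Closure rules for composed arguments: computability of an expression then follows by
  recursion on its syntax.\<close>

lemmas tc_Suc [tc_intros] = tc_app1[OF tc_Suc']
lemmas tc_pfst [tc_intros] = tc_app1[OF tc_pfst']
lemmas tc_psnd [tc_intros] = tc_app1[OF tc_psnd']
lemmas tc_plus [tc_intros] = tc_app2[OF tc2_plus]
lemmas tc_minus [tc_intros] = tc_app2[OF tc2_minus]
lemmas tc_pair [tc_intros] = tc_app2[OF tc2_pair]

lemma tc3_uncurry:
  assumes "total_computable (\<lambda>w. s (pfst w) (pfst (psnd w)) (psnd (psnd w)))"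
  shows "total_computable3 s"
  using tc3_app1[OF assms tc3_app2[OF tc2_pair tc3_proj(1) tc3_app2[OF tc2_pair tc3_proj(2,3)]]]
  by simp

text \<open>The step may depend on the outer argument \<open>x\<close>. It is treated as a unary
  function of the nested pair of \<open>x\<close>, the counter and the previous value, so that its
  computability is again a goal for the closure rules.\<close>

lemma tc_rec [tc_intros]:
  assumes "total_computable a" "total_computable m"
    and "total_computable (\<lambda>w. s (pfst w) (pfst (psnd w)) (psnd (psnd w)))"
  shows "total_computable (\<lambda>x. rec_nat (a x) (s x) (m x))"
proof -
  have "total_computable3 (\<lambda>n r x. s x n r)"
    using tc3_app1[OF assms(3) tc3_app2[OF tc2_pair tc3_proj(3) tc3_app2[OF tc2_pair tc3_proj(1,2)]]]
    by simp
  from tc_app2[OF tc2_rec[OF assms(1) this] assms(2) tc_id] show ?thesis by simp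
qed

lemma tc_funpow:
  assumes "total_computable a" "total_computable m"
    and "total_computable (\<lambda>w. s (pfst w) (psnd w))"
  shows "total_computable (\<lambda>x. (s x ^^ m x) (a x))"
proof -
  have "total_computable (\<lambda>w. s (pfst w) (psnd (psnd w)))"
    using tc_app1[OF assms(3) tc_pair[OF tc_pfst[OF tc_id] tc_psnd[OF tc_psnd[OF tc_id]]]] by simp
  with assms have "total_computable (\<lambda>x. rec_nat (a x) (\<lambda>_. s x) (m x))"
    by (intro tc_rec)
  moreover have "rec_nat b (\<lambda>_. g) n = (g ^^ n) b" for b n :: nat and g
    by (induction n) auto
  ultimately show ?thesis by simp
qed

section \<open>Decidable predicates and case distinction\<close>

definition decidable :: "(nat \<Rightarrow> bool) \<Rightarrow> bool" where
  "decidable P \<longleftrightarrow> total_computable (\<lambda>x. if P x then 1 else 0)"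

text \<open>The truth value serves as the length of a recursion: length 0 leaves \<open>b x\<close>,
  length 1 replaces it by \<open>a x\<close>.\<close>

lemma tc_if [tc_intros]:
  assumes "decidable P" "total_computable a" "total_computable b"
  shows "total_computable (\<lambda>x. if P x then a x else b x)"
proof -
  have "total_computable (\<lambda>x. rec_nat (b x) (\<lambda>_ _. a x) (if P x then 1 else 0))"
    using assms unfolding decidable_def
    by (intro tc_rec tc_app1[OF assms(2)] tc_intros)
  then show ?thesis by (rule back_subst[of total_computable]) auto
qed

text \<open>Two numbers are equal iff both truncated differences vanish.\<close>

lemma dec_eq [tc_intros]:
  assumes "total_computable a" "total_computable b"
  shows "decidable (\<lambda>x. a x = b x)"
proof -
  have "total_computable (\<lambda>x. 1 - ((a x - b x) + (b x - a x)))"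
    by (intro tc_intros assms)
  then show ?thesis unfolding decidable_def by (rule back_subst[of total_computable]) auto
qed

lemma dec_not [tc_intros]: "decidable P \<Longrightarrow> decidable (\<lambda>x. \<not> P x)"
proof -
  assume "decidable P"
  then have "total_computable (\<lambda>x. if P x then 0 else 1)" by (intro tc_intros)
  then show ?thesis unfolding decidable_def by (rule back_subst[of total_computable]) auto
qed

lemma dec_conj [tc_intros]:
  assumes "decidable P" "decidable Q" shows "decidable (\<lambda>x. P x \<and> Q x)"
proof -
  have "total_computable (\<lambda>x. if P x then (if Q x then 1 else 0) else 0)"
    by (intro tc_intros assms)
  then show ?thesis unfolding decidable_def by (rule back_subst[of total_computable]) auto
qed

lemma dec_disj [tc_intros]:
  assumes "decidable P" "decidable Q" shows "decidable (\<lambda>x. P x \<or> Q x)"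
  using dec_not[OF dec_conj[OF dec_not[OF assms(1)] dec_not[OF assms(2)]]] by simp

lemma dec_imp [tc_intros]:
  assumes "decidable P" "decidable Q" shows "decidable (\<lambda>x. P x \<longrightarrow> Q x)"
  using dec_disj[OF dec_not[OF assms(1)] assms(2)] by simp

lemma decidable3I:
  assumes "decidable (\<lambda>w. P (pfst w) (pfst (psnd w)) (psnd (psnd w)))"
  shows "decidable3 P"
  using tc3_uncurry[of "\<lambda>x y z. if P x y z then 1 else 0"] assms
  unfolding decidable3_def decidable_def total_computable3_def by simp

section \<open>Codes of lists\<close>

text \<open>The code of a nonempty list is the successor of a pair. On 0, the code of the empty
  list, truncated subtraction gives the default 0 in both cases, because
  \<open>pair 0 0 = 0\<close>.\<close>

definition hdc :: "nat \<Rightarrow> nat" where "hdc l = pfst (l - 1)"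
definition tlc :: "nat \<Rightarrow> nat" where "tlc l = psnd (l - 1)"
definition consc :: "nat \<Rightarrow> nat \<Rightarrow> nat" where "consc a l = Suc (pair a l)"

lemma list_encode_Cons: "list_encode (x # xs) = consc x (list_encode xs)"
  by (simp add: consc_def pair_def)

declare list_encode.simps(2) [simp del] list_encode_Cons [simp]

lemma hdc_consc [simp]: "hdc (consc a l) = a" and tlc_consc [simp]: "tlc (consc a l) = l"
  and consc_neq_0 [simp]: "consc a l \<noteq> 0"
  by (simp_all add: hdc_def tlc_def consc_def)

lemma tc_hdc [tc_intros]: "total_computable f \<Longrightarrow> total_computable (\<lambda>x. hdc (f x))"
  unfolding hdc_def by (intro tc_intros)

lemma tc_tlc [tc_intros]: "total_computable f \<Longrightarrow> total_computable (\<lambda>x. tlc (f x))"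
  unfolding tlc_def by (intro tc_intros)

lemma tc_consc [tc_intros]:
  "total_computable f \<Longrightarrow> total_computable g \<Longrightarrow> total_computable (\<lambda>x. consc (f x) (g x))"
  unfolding consc_def by (intro tc_intros)

lemma pair_0_0: "pair 0 0 = 0"
  by (simp add: pair_def prod_encode_def)

lemma tlc_0 [simp]: "tlc 0 = 0" and hdc_0 [simp]: "hdc 0 = 0"
  using pfst_pair[of 0 0] psnd_pair[of 0 0] by (simp_all add: pair_0_0 tlc_def hdc_def)

lemma tlc_list_encode [simp]: "tlc (list_encode xs) = list_encode (tl xs)"
  by (cases xs) simp_all

lemma tlc_funpow_list_encode: "(tlc ^^ n) (list_encode xs) = list_encode (drop n xs)"
  by (induction n arbitrary: xs) (simp_all add: drop_Suc tl_drop)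

lemma hdc_list_encode: "xs \<noteq> [] \<Longrightarrow> hdc (list_encode xs) = hd xs"
  by (cases xs) simp_all

text \<open>Lets the code of a list serve as a bound on the number of iterations of a fold.\<close>

lemma length_le_list_encode: "length xs \<le> list_encode xs"
proof (induction xs)
  case (Cons x xs)
  then show ?case using le_prod_encode_2[of "list_encode xs" x] by (simp add: consc_def pair_def)
qed simp

text \<open>Makes recursion on term codes well-founded: arguments have smaller codes than the
  term.\<close>

lemma mem_less_list_encode: "x \<in> set xs \<Longrightarrow> x < list_encode xs"
proof (induction xs)
  case (Cons y xs)
  then show ?case using le_prod_encode_2[of "list_encode xs" y] le_prod_encode_1[of y "list_encode xs"]
    by (auto simp: consc_def pair_def)
qed simp

definition nthc :: "nat \<Rightarrow> nat \<Rightarrow> nat" where "nthc l i = hdc ((tlc ^^ i) l)"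

lemma nthc_list_encode: "i < length xs \<Longrightarrow> nthc (list_encode xs) i = xs ! i"
  by (simp add: nthc_def tlc_funpow_list_encode hdc_list_encode hd_drop_conv_nth)

lemma tc_dropc [tc_intros]:
  assumes "total_computable l" "total_computable i"
  shows "total_computable (\<lambda>x. (tlc ^^ i x) (l x))"
  by (intro tc_funpow tc_intros assms)

lemma tc_nthc [tc_intros]:
  assumes "total_computable l" "total_computable i"
  shows "total_computable (\<lambda>x. nthc (l x) (i x))"
  unfolding nthc_def by (intro tc_intros assms)

text \<open>The fold iterates a step on pairs of accumulator and remaining list. The step idles once
  the list is empty, so any number of iterations that is at least the length will do, in particular
  the code of the list.\<close>

lemma tc_foldl [tc_intros]:
  assumes "total_computable a" "total_computable l"
    and "total_computable (\<lambda>w. f (pfst w) (pfst (psnd w)) (psnd (psnd w)))"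
  shows "total_computable (\<lambda>x. foldl (f x) (a x) (list_decode (l x)))"
proof -
  define s where "s x st = (if psnd st = 0 then st
    else pair (f x (pfst st) (hdc (psnd st))) (tlc (psnd st)))" for x st
  have run: "(s x ^^ n) (pair b (list_encode xs)) = pair (foldl (f x) b xs) 0"
    if "length xs \<le> n" for x n b xs using that
  proof (induction n arbitrary: b xs)
    case (Suc n)
    show ?case
    proof (cases xs)
      case Nil
      then have "s x (pair b (list_encode xs)) = pair b (list_encode xs)" by (simp add: s_def)
      then show ?thesis using Suc.IH[of xs b] Nil by (simp add: funpow_swap1)
    next
      case (Cons y ys)
      then have "s x (pair b (list_encode xs)) = pair (f x b y) (list_encode ys)"
        by (simp add: s_def)
      then show ?thesis using Suc Cons by (simp add: funpow_swap1)
    qed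
  qed simp
  have "total_computable (\<lambda>w. f (pfst w) (pfst (psnd w)) (hdc (psnd (psnd w))))"
    using tc_app1[OF assms(3), of "\<lambda>w. pair (pfst w) (pair (pfst (psnd w)) (hdc (psnd (psnd w))))"]
    by (simp add: tc_intros)
  then have "total_computable (\<lambda>w. s (pfst w) (psnd w))"
    unfolding s_def by (intro tc_intros)
  then have "total_computable (\<lambda>x. pfst ((s x ^^ l x) (pair (a x) (l x))))"
    by (intro tc_pfst tc_funpow tc_intros assms)
  moreover have "pfst ((s x ^^ l x) (pair (a x) (l x))) = foldl (f x) (a x) (list_decode (l x))" for x
    using run[of "list_decode (l x)" "l x" x "a x"] length_le_list_encode[of "list_decode (l x)"] by simp
  ultimately show ?thesis by simp
qed

text \<open>A left fold builds lists backwards. Reversal onto a tail repairs the order when mapping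
  and later fills the hole of a frame.\<close>

definition revappc :: "nat \<Rightarrow> nat \<Rightarrow> nat" where
  "revappc l m = foldl (\<lambda>acc e. consc e acc) m (list_decode l)"

lemma revappc_list_encode: "revappc (list_encode xs) (list_encode ys) = list_encode (rev xs @ ys)"
proof -
  have "foldl (\<lambda>acc e. consc e acc) (list_encode ys) xs = list_encode (rev xs @ ys)"
    by (induction xs arbitrary: ys)
      (simp_all del: list_encode_Cons add: list_encode_Cons[symmetric])
  then show ?thesis by (simp add: revappc_def)
qed

lemma tc_revappc [tc_intros]:
  "total_computable f \<Longrightarrow> total_computable g \<Longrightarrow> total_computable (\<lambda>x. revappc (f x) (g x))"
  unfolding revappc_def by (intro tc_intros)

lemma tc_map [tc_intros]:
  assumes "total_computable l" "total_computable (\<lambda>w. f (pfst w) (psnd w))"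
  shows "total_computable (\<lambda>x. list_encode (map (f x) (list_decode (l x))))"
proof -
  have eq: "foldl (\<lambda>acc e. consc (f x e) acc) (list_encode ys) xs = list_encode (rev (map (f x) xs) @ ys)"
    for x xs ys by (induction xs arbitrary: ys)
      (simp_all del: list_encode_Cons add: list_encode_Cons[symmetric])
  have "total_computable (\<lambda>w. f (pfst w) (psnd (psnd w)))"
    using tc_app1[OF assms(2), of "\<lambda>w. pair (pfst w) (psnd (psnd w))"] by (simp add: tc_intros)
  then have "total_computable
      (\<lambda>x. revappc (foldl (\<lambda>acc e. consc (f x e) acc) 0 (list_decode (l x))) 0)"
    by (intro tc_intros assms)
  then show ?thesis
    using eq[of _ "[]"] revappc_list_encode[of _ "[]"] by simp
qed

text \<open>The recursion carries the list of all earlier values, latest first; the value at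
  \<open>m < n\<close> therefore stands at position \<open>n - Suc m\<close>.\<close>

lemma tc_course_of_values:
  assumes "total_computable (\<lambda>w. G (pfst w) (pfst (psnd w)) (psnd (psnd w)))"
    and h: "\<And>x n. h x n = G x n (list_encode (rev (map (h x) [0..<n])))"
    and "total_computable a" "total_computable b"
  shows "total_computable (\<lambda>x. h (a x) (b x))"
proof -
  have eq: "rec_nat 0 (\<lambda>n r. consc (G x n r) r) m = list_encode (rev (map (h x) [0..<m]))" for x m
    by (induction m) (simp_all add: h[symmetric])
  have 1: "total_computable (\<lambda>w. G (a (pfst w)) (pfst (psnd w)) (psnd (psnd w)))"
    using tc_app1[OF assms(1), of "\<lambda>w. pair (a (pfst w)) (psnd w)"] 
      tc_app1[OF assms(3) tc_pfst[OF tc_id]] by (simp add: tc_intros)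
  \<comment> \<open>After \<open>Suc (b x)\<close> rounds the value at \<open>b x\<close> is the
    head of the history.\<close>
  have "total_computable (\<lambda>x. hdc (rec_nat 0 (\<lambda>n r. consc (G (a x) n r) r) (Suc (b x))))"
    by (intro tc_intros 1 assms)
  then show ?thesis unfolding eq by simp
qed

section \<open>Membership: rewriting on codes\<close>

lemma inj_enc_term: "enc_term s = enc_term t \<Longrightarrow> s = t"
proof (induction s arbitrary: t)
  case (Var x) then show ?case by (cases t) auto
next
  case (Fun f ss)
  then obtain ts where t: "t = Fun f ts" "map enc_term ss = map enc_term ts"
    by (cases t) (auto simp: list_encode_eq)
  then have "ss = ts"
    using Fun.IH by (intro nth_equalityI) (auto dest: map_eq_imp_length_eq simp: list_eq_iff_nth_eq)
  with t show ?case by simp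
qed

lemma mem_list_decode_less: "m \<in> set (list_decode l) \<Longrightarrow> m < pair k l"
  using mem_less_list_encode[of m "list_decode l"] le_prod_encode_2[of l k] by (simp add: pair_def)

text \<open>The tag 0 marks a variable and \<open>Suc f\<close> the symbol \<open>f\<close> of any
  arity, so no tag is left over; argument codes are smaller, which permits strong induction.\<close>

lemma surj_enc_term: "\<exists>t. enc_term t = n"
proof (induction n rule: less_induct)
  case (less n)
  obtain a l where n: "n = pair a l" by (rule pair_cases)
  show ?case
  proof (cases a)
    case 0 then show ?thesis using n by (auto simp: pair_def intro: exI[of _ "Var l"])
  next
    case (Suc f)
    have "\<forall>m\<in>set (list_decode l). \<exists>t. enc_term t = m"
      using less mem_list_decode_less n by blast
    then obtain h where "\<forall>m\<in>set (list_decode l). enc_term (h m) = m" by metis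
    then have "enc_term (Fun f (map h (list_decode l))) = n"
      by (simp add: n Suc pair_def comp_def map_idI)
    then show ?thesis by blast
  qed
qed

definition dec_term :: "nat \<Rightarrow> trm" where "dec_term = inv enc_term"

lemma dec_enc_term [simp]: "dec_term (enc_term t) = t"
  unfolding dec_term_def by (intro inv_f_f injI inj_enc_term)

lemma enc_dec_term [simp]: "enc_term (dec_term n) = n"
  unfolding dec_term_def by (intro f_inv_into_f) (metis surj_enc_term rangeI)

lemma dec_term_pair_0: "dec_term (pair 0 v) = Var v"
  using dec_enc_term[of "Var v"] by (simp add: pair_def)

lemma dec_term_pair_Suc: "dec_term (pair (Suc f) l) = Fun f (map dec_term (list_decode l))"
  using dec_enc_term[of "Fun f (map dec_term (list_decode l))"] by (simp add: pair_def comp_def)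

lemma pfst_enc_term_eq_0: "pfst (enc_term t) = 0 \<longleftrightarrow> (\<exists>x. t = Var x)"
  by (cases t) (simp_all flip: pair_def)

section \<open>Substitutions coded by numbers\<close>

lemma subst_cong: "(\<And>x. x \<in> vars t \<Longrightarrow> \<sigma> x = \<tau> x) \<Longrightarrow> subst \<sigma> t = subst \<tau> t"
  by (induction t) auto

lemma subst_eq_self_iff: "subst \<sigma> t = t \<longleftrightarrow> (\<forall>x\<in>vars t. \<sigma> x = Var x)"
proof (induction t)
  case (Fun f ts)
  have "map (subst \<sigma>) us = us \<longleftrightarrow> (\<forall>u\<in>set us. subst \<sigma> u = u)" for us
    by (induction us) auto
  with Fun show ?case by auto
qed simp

lemma finite_vars: "finite (vars t)"
  by (induction t) auto

text \<open>The code lists the images of the variables 0, 1, and so on; variables past its end are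
  fixed. Thus every number codes a substitution.\<close>

definition sub_of :: "nat \<Rightarrow> nat \<Rightarrow> trm" where
  "sub_of c x = (if (tlc ^^ x) c = 0 then Var x else dec_term (nthc c x))"

definition substc :: "nat \<Rightarrow> nat \<Rightarrow> nat" where
  "substc c n = enc_term (subst (sub_of c) (dec_term n))"

lemma list_encode_eq_0 [simp]: "list_encode xs = 0 \<longleftrightarrow> xs = []"
  by (cases xs) auto

text \<open>Coded substitutions move finitely many variables only, which is enough because a rule
  contains finitely many.\<close>

lemma sub_of_exists:
  assumes "finite V"
  shows "\<exists>c. \<forall>x\<in>V. sub_of c x = \<sigma> x"
proof -
  obtain N where N: "\<forall>x\<in>V. x < N"
    using assms by (metis finite_nat_set_iff_bounded)
  have "sub_of (list_encode (map (\<lambda>x. enc_term (\<sigma> x)) [0..<N])) x = \<sigma> x" if "x < N" for x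
    using that by (simp add: sub_of_def tlc_funpow_list_encode nthc_list_encode)
  with N show ?thesis by blast
qed

text \<open>Course-of-values recursion on the term code: the images of the arguments are looked up
  in the history.\<close>

lemma tc_substc [tc_intros]:
  assumes "total_computable a" "total_computable b"
  shows "total_computable (\<lambda>x. substc (a x) (b x))"
proof (rule tc_course_of_values[OF _ _ assms])
  define G where "G c n hist = (if pfst n = 0 then (if (tlc ^^ psnd n) c = 0 then n else nthc c (psnd n))
    else pair (pfst n) (list_encode (map (\<lambda>m. nthc hist (n - Suc m)) (list_decode (psnd n)))))"
    for c n hist
  show "total_computable (\<lambda>w. G (pfst w) (pfst (psnd w)) (psnd (psnd w)))"
    unfolding G_def by (intro tc_intros)
  show "substc c n = G c n (list_encode (rev (map (substc c) [0..<n])))" for c n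
  proof -
    obtain k l where n: "n = pair k l" by (rule pair_cases)
    show ?thesis
    proof (cases k)
      case 0 then show ?thesis
        by (simp add: n substc_def G_def dec_term_pair_0 sub_of_def) (simp add: pair_def)
    next
      case (Suc f)
      have "nthc (list_encode (rev (map (substc c) [0..<n]))) (n - Suc m) = substc c m"
        if "m \<in> set (list_decode l)" for m
      proof -
        have "m < n" using mem_list_decode_less[OF that] n by simp
        then show ?thesis by (simp add: nthc_list_encode rev_nth)
      qed
      then show ?thesis
        by (simp add: n Suc G_def substc_def dec_term_pair_Suc cong: map_cong)
          (simp add: substc_def comp_def pair_def)
    qed
  qed
qed

text \<open>A frame \<open>(f, (xs, ys))\<close> is the context \<open>Fun f (rev xs @ \<box> # ys)\<close>; contexts are lists of
  frames, innermost first.\<close>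

definition framec :: "nat \<Rightarrow> nat \<Rightarrow> nat" where
  "framec u fr = pair (Suc (pfst fr)) (revappc (pfst (psnd fr)) (consc u (psnd (psnd fr))))"

definition plugc :: "nat \<Rightarrow> nat \<Rightarrow> nat" where
  "plugc K u = foldl framec u (list_decode K)"

text \<open>The choice \<open>c\<close> packs a rule index, a context and a substitution; an unsuitable choice leaves
  the term unchanged. An index out of range is harmless, since \<open>nthc\<close> then returns \<open>0\<close>, the code
  of the rule \<open>(Var 0, Var 0)\<close>.\<close>

definition stepc :: "nat \<Rightarrow> nat \<Rightarrow> nat \<Rightarrow> nat" where
  "stepc R s c =
    (if s = plugc (pfst (psnd c)) (substc (psnd (psnd c)) (pfst (nthc R (pfst c))))
     then plugc (pfst (psnd c)) (substc (psnd (psnd c)) (psnd (nthc R (pfst c)))) else s)"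

definition reachc :: "nat \<Rightarrow> nat \<Rightarrow> nat \<Rightarrow> nat" where
  "reachc R s cs = foldl (stepc R) s (list_decode cs)"

lemma tc_plugc [tc_intros]:
  "total_computable f \<Longrightarrow> total_computable g \<Longrightarrow> total_computable (\<lambda>x. plugc (f x) (g x))"
  unfolding plugc_def framec_def by (intro tc_intros)

lemma tc_stepc [tc_intros]:
  "total_computable f \<Longrightarrow> total_computable g \<Longrightarrow> total_computable h
    \<Longrightarrow> total_computable (\<lambda>x. stepc (f x) (g x) (h x))"
  unfolding stepc_def by (intro tc_intros)

lemma tc_reachc [tc_intros]:
  assumes "total_computable f" "total_computable g" "total_computable h"
  shows "total_computable (\<lambda>x. reachc (f x) (g x) (h x))"
proof -
  have "total_computable (\<lambda>w. f (pfst w))" by (rule tc_app1[OF assms(1)]) (intro tc_intros)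
  then show ?thesis unfolding reachc_def by (intro tc_intros assms)
qed

lemma dec_framec:
  "dec_term (framec u fr) = Fun (pfst fr) (rev (map dec_term (list_decode (pfst (psnd fr))))
    @ dec_term u # map dec_term (list_decode (psnd (psnd fr))))"
  using revappc_list_encode[of "list_decode (pfst (psnd fr))" "u # list_decode (psnd (psnd fr))"]
  by (simp add: framec_def dec_term_pair_Suc rev_map)

lemma rstep_append:
  "rstep R s t \<Longrightarrow> rstep R (Fun f (xs @ s # ys)) (Fun f (xs @ t # ys))"
  using rstep.ctxt[of R s t "length xs" "xs @ s # ys" f] by simp

lemma rstep_plugc:
  assumes "rstep R (dec_term u) (dec_term v)"
  shows "rstep R (dec_term (plugc K u)) (dec_term (plugc K v))"
proof -
  have "rstep R (dec_term (foldl framec u frs)) (dec_term (foldl framec v frs))" for frs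
    using assms by (induction frs arbitrary: u v) (simp_all add: dec_framec rstep_append)
  then show ?thesis by (simp add: plugc_def)
qed

lemma nthc_enc_trs:
  "j < length R \<Longrightarrow> nthc (enc_trs R) j = pair (enc_term (fst (R ! j))) (enc_term (snd (R ! j)))"
  by (simp add: enc_trs_def nthc_list_encode enc_rule_def pair_def)

lemma dropc_enc_trs_eq_0: "(tlc ^^ j) (enc_trs R) = 0 \<longleftrightarrow> length R \<le> j"
  by (simp add: enc_trs_def tlc_funpow_list_encode)

lemma nthc_enc_trs_overflow: "length R \<le> j \<Longrightarrow> nthc (enc_trs R) j = 0"
  by (simp add: nthc_def dropc_enc_trs_eq_0[THEN iffD2])

lemma pfst_0 [simp]: "pfst 0 = 0" and psnd_0 [simp]: "psnd 0 = 0"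
  using pfst_pair[of 0 0] psnd_pair[of 0 0] by (simp_all add: pair_0_0)

lemma stepc_sound: "(rstep R)\<^sup>*\<^sup>* (dec_term s) (dec_term (stepc (enc_trs R) s c))"
proof (cases "pfst c < length R \<and>
    s = plugc (pfst (psnd c)) (substc (psnd (psnd c)) (pfst (nthc (enc_trs R) (pfst c))))")
  case True
  then have "(fst (R ! pfst c), snd (R ! pfst c)) \<in> set R" by simp
  from rstep.root[OF this]
  have "rstep R (dec_term s) (dec_term (stepc (enc_trs R) s c))"
    using True unfolding stepc_def
    by (auto simp: nthc_enc_trs substc_def intro!: rstep_plugc)
  then show ?thesis by blast
next
  case False
  then have "stepc (enc_trs R) s c = s"
    by (auto simp: stepc_def nthc_enc_trs_overflow)
  then show ?thesis by simp
qed

lemma stepc_complete: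
  assumes "rstep R s t"
  shows "\<exists>c. stepc (enc_trs R) (enc_term s) c = enc_term t"
proof -
  \<comment> \<open>The induction keeps rule, context and substitution apart: a context step extends
    \<open>K\<close> by an outer frame, at the end of the list, and leaves the other two
    alone.\<close>
  have "\<exists>j K c. enc_term s = plugc K (substc c (pfst (nthc (enc_trs R) j))) \<and>
      enc_term t = plugc K (substc c (psnd (nthc (enc_trs R) j)))"
    using assms
  proof induction
    case (root l r \<sigma>)
    then obtain j where j: "j < length R" "R ! j = (l, r)" by (auto simp: in_set_conv_nth)
    obtain c where "\<forall>x\<in>vars l \<union> vars r. sub_of c x = \<sigma> x"
      using sub_of_exists[of "vars l \<union> vars r" \<sigma>] finite_vars by blast
    then have "subst (sub_of c) l = subst \<sigma> l" "subst (sub_of c) r = subst \<sigma> r"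
      by (auto intro: subst_cong)
    then show ?case
      using j by (intro exI[of _ j] exI[of _ 0] exI[of _ c]) (simp add: plugc_def nthc_enc_trs substc_def)
  next
    case (ctxt s t i ss f)
    then obtain j K c where
      IH: "enc_term s = plugc K (substc c (pfst (nthc (enc_trs R) j)))"
          "enc_term t = plugc K (substc c (psnd (nthc (enc_trs R) j)))" by blast
    define fr where "fr = pair f (pair (list_encode (rev (map enc_term (take i ss))))
      (list_encode (map enc_term (drop (Suc i) ss))))"
    have fr: "enc_term (Fun f (ss[i := u])) = framec (enc_term u) fr" for u
      using revappc_list_encode[of "rev (map enc_term (take i ss))"
          "enc_term u # map enc_term (drop (Suc i) ss)"] ctxt(2)
      by (simp add: framec_def fr_def upd_conv_take_nth_drop) (simp add: pair_def)
    have "plugc (list_encode (list_decode K @ [fr])) u = framec (plugc K u) fr" for u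
      by (simp add: plugc_def)
    then show ?case
      using IH fr by metis
  qed
  then obtain j K c where "enc_term s = plugc K (substc c (pfst (nthc (enc_trs R) j)))"
      "enc_term t = plugc K (substc c (psnd (nthc (enc_trs R) j)))" by blast
  then have "stepc (enc_trs R) (enc_term s) (pair j (pair K c)) = enc_term t"
    by (simp add: stepc_def)
  then show ?thesis by blast
qed

lemma rsteps_iff_reachc:
  "(rstep R)\<^sup>*\<^sup>* s t \<longleftrightarrow> (\<exists>cs. reachc (enc_trs R) (enc_term s) cs = enc_term t)"
proof
  assume "(rstep R)\<^sup>*\<^sup>* s t"
  then show "\<exists>cs. reachc (enc_trs R) (enc_term s) cs = enc_term t"
  proof induction
    case base show ?case by (auto simp: reachc_def intro: exI[of _ 0])
  next
    case (step t u)
    then obtain cs c where "reachc (enc_trs R) (enc_term s) cs = enc_term t"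
      "stepc (enc_trs R) (enc_term t) c = enc_term u" using stepc_complete by blast
    then have "reachc (enc_trs R) (enc_term s) (list_encode (list_decode cs @ [c])) = enc_term u"
      by (simp add: reachc_def)
    then show ?case by blast
  qed
next
  have "(rstep R)\<^sup>*\<^sup>* (dec_term n) (dec_term (foldl (stepc (enc_trs R)) n cs))" for n cs
    by (induction cs arbitrary: n) (auto intro: rtranclp_trans[OF stepc_sound])
  moreover assume "\<exists>cs. reachc (enc_trs R) (enc_term s) cs = enc_term t"
  ultimately show "(rstep R)\<^sup>*\<^sup>* s t"
    unfolding reachc_def by (metis dec_enc_term)
qed

section \<open>The arithmetical form of confluence\<close>

lemma enc_pair_inj: "enc_pair R t = enc_pair S u \<Longrightarrow> R = S \<and> t = u"
proof -
  assume "enc_pair R t = enc_pair S u"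
  then have "map enc_rule R = map enc_rule S" "t = u"
    by (auto simp: enc_pair_def enc_trs_def list_encode_eq dest: inj_enc_term)
  moreover have "inj enc_rule"
    by (rule injI) (auto simp: enc_rule_def dest: inj_enc_term intro: prod_eqI)
  ultimately show ?thesis by (auto dest: map_injective)
qed

lemma enc_pair_surj: obtains R t where "n = enc_pair R t"
proof -
  obtain a b where n: "n = pair a b" by (rule pair_cases)
  have "enc_rule (dec_term (pfst m), dec_term (psnd m)) = m" for m
    by (simp add: enc_rule_def flip: pair_def)
  then have "enc_trs (map (\<lambda>m. (dec_term (pfst m), dec_term (psnd m))) (list_decode a)) = a"
    by (simp add: enc_trs_def comp_def)
  then have "n = enc_pair (map (\<lambda>m. (dec_term (pfst m), dec_term (psnd m))) (list_decode a)) (dec_term b)"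
    by (simp add: n enc_pair_def pair_def)
  then show ?thesis by (rule that)
qed

text \<open>Whether a variable occurs in a term is tested by substitutions: \<open>vars r \<subseteq> vars l\<close> iff every
  substitution fixing \<open>l\<close> fixes \<open>r\<close>, and a term is ground iff every substitution fixes it.
  The universal quantifier over substitutions is merged into the outer one.\<close>

lemma vars_subset_iff:
  "vars r \<subseteq> vars l \<longleftrightarrow> (\<forall>c. subst (sub_of c) l = l \<longrightarrow> subst (sub_of c) r = r)"
proof
  assume *: "\<forall>c. subst (sub_of c) l = l \<longrightarrow> subst (sub_of c) r = r"
  show "vars r \<subseteq> vars l"
  proof (rule ccontr)
    assume "\<not> vars r \<subseteq> vars l"
    then obtain x where x: "x \<in> vars r" "x \<notin> vars l" by blast
    \<comment> \<open>The witness moves only \<open>x\<close>: it fixes \<open>l\<close>, where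
      \<open>x\<close> does not occur, but not \<open>r\<close>.\<close>
    obtain c where c: "\<forall>y\<in>vars l \<union> vars r. sub_of c y = (Var(x := Fun 0 [])) y"
      using sub_of_exists[of "vars l \<union> vars r" "Var(x := Fun 0 [])"] finite_vars by blast
    then have "subst (sub_of c) l = l"
      using x by (auto simp: subst_eq_self_iff)
    with * have "sub_of c x = Var x"
      using x by (simp add: subst_eq_self_iff)
    with c x show False by simp
  qed
qed (auto simp: subst_eq_self_iff)

lemma ground_iff: "ground t \<longleftrightarrow> (\<forall>c. subst (sub_of c) t = t)"
  \<comment> \<open>Groundness is inclusion of the variables in those of a constant.\<close>
  using vars_subset_iff[of t "Fun 0 []"] by (simp add: ground_def)

text \<open>Well-formedness, groundness and joinability share one decidable matrix. The tag 0 marks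
  variables, so the first conjunct forbids variable left-hand sides; its first alternative covers
  \<open>j\<close> past the last rule.\<close>

definition conf_matrix :: "bool \<Rightarrow> nat \<Rightarrow> nat \<Rightarrow> nat \<Rightarrow> nat \<Rightarrow> nat \<Rightarrow> nat \<Rightarrow> nat \<Rightarrow> nat \<Rightarrow> bool" where
  "conf_matrix g R t j c y1 y2 z1 z2 \<longleftrightarrow>
    ((tlc ^^ j) R = 0 \<or> pfst (pfst (nthc R j)) \<noteq> 0) \<and>
    (substc c (pfst (nthc R j)) = pfst (nthc R j) \<longrightarrow> substc c (psnd (nthc R j)) = psnd (nthc R j)) \<and>
    (g \<longrightarrow> substc c t = t) \<and>
    reachc R (reachc R t y1) z1 = reachc R (reachc R t y2) z2"

lemma substc_enc_term_eq: "substc c (enc_term t) = enc_term t \<longleftrightarrow> subst (sub_of c) t = t"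
  by (auto simp: substc_def dest: inj_enc_term)

lemma is_trs_iff:
  "is_trs R \<longleftrightarrow> (\<forall>j c. ((tlc ^^ j) (enc_trs R) = 0 \<or> pfst (pfst (nthc (enc_trs R) j)) \<noteq> 0) \<and>
    (substc c (pfst (nthc (enc_trs R) j)) = pfst (nthc (enc_trs R) j) \<longrightarrow>
     substc c (psnd (nthc (enc_trs R) j)) = psnd (nthc (enc_trs R) j)))"
  (is "_ \<longleftrightarrow> (\<forall>j c. ?Q j c)")
proof -
  \<comment> \<open>Past the end of \<open>R\<close> both sides of the default rule are 0, so the
    second conjunct holds there trivially.\<close>
  have eq: "(\<forall>c. ?Q j c) \<longleftrightarrow> (j < length R \<longrightarrow> (\<forall>x. fst (R ! j) \<noteq> Var x) \<and> vars (snd (R ! j)) \<subseteq> vars (fst (R ! j)))"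
    for j
    by (cases "j < length R")
      (auto simp: dropc_enc_trs_eq_0 nthc_enc_trs nthc_enc_trs_overflow pfst_enc_term_eq_0
        substc_enc_term_eq vars_subset_iff)
  show ?thesis
    unfolding eq by (simp add: is_trs_def all_set_conv_all_nth case_prod_beta)
qed

lemma confluent_on_iff:
  "confluent_on R t \<longleftrightarrow> (\<forall>y1 y2. \<exists>z1 z2. reachc (enc_trs R) (reachc (enc_trs R) (enc_term t) y1) z1
    = reachc (enc_trs R) (reachc (enc_trs R) (enc_term t) y2) z2)"
  (is "_ \<longleftrightarrow> ?rhs")
proof
  assume conf: "confluent_on R t"
  show ?rhs
  proof (intro allI)
    fix y1 y2
    let ?r = "\<lambda>y. reachc (enc_trs R) (enc_term t) y"
    have "(rstep R)\<^sup>*\<^sup>* t (dec_term (?r y))" for y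
      by (auto simp: rsteps_iff_reachc)
    with conf obtain d where "(rstep R)\<^sup>*\<^sup>* (dec_term (?r y1)) d" "(rstep R)\<^sup>*\<^sup>* (dec_term (?r y2)) d"
      unfolding confluent_on_def by meson
    then show "\<exists>z1 z2. reachc (enc_trs R) (?r y1) z1 = reachc (enc_trs R) (?r y2) z2"
      unfolding rsteps_iff_reachc by (metis enc_dec_term)
  qed
next
  assume *: ?rhs
  show "confluent_on R t"
    unfolding confluent_on_def
  proof (intro allI impI)
    fix t1 t2 assume "(rstep R)\<^sup>*\<^sup>* t t1" "(rstep R)\<^sup>*\<^sup>* t t2"
    then obtain z1 z2 where "reachc (enc_trs R) (enc_term t1) z1 = reachc (enc_trs R) (enc_term t2) z2"
      unfolding rsteps_iff_reachc using * by metis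
    then show "\<exists>d. (rstep R)\<^sup>*\<^sup>* t1 d \<and> (rstep R)\<^sup>*\<^sup>* t2 d"
      unfolding rsteps_iff_reachc by (metis enc_dec_term)
  qed
qed

text \<open>The quantifiers distribute over the conjuncts, since only the last one mentions the
  \<open>y\<close> and \<open>z\<close> variables and it mentions neither \<open>j\<close> nor
  \<open>c\<close>.\<close>

lemma conf_matrix_iff:
  "(\<forall>j c y1 y2. \<exists>z1 z2. conf_matrix g (enc_trs R) (enc_term t) j c y1 y2 z1 z2) \<longleftrightarrow>
    is_trs R \<and> (g \<longrightarrow> ground t) \<and> confluent_on R t"
  unfolding conf_matrix_def is_trs_iff ground_iff confluent_on_iff substc_enc_term_eq by blast

text \<open>The flag \<open>g\<close> treats both sets at once. Nested pairs contract each
  quantifier block to a single quantifier.\<close>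

lemma Pi02_confluent_on:
  "Pi02 {enc_pair R t | R t. is_trs R \<and> (g \<longrightarrow> ground t) \<and> confluent_on R t}"
  unfolding Pi02_def
proof (intro exI conjI allI)
  let ?P = "\<lambda>x y z. conf_matrix g (pfst x) (psnd x) (pfst y) (pfst (psnd y))
    (pfst (psnd (psnd y))) (psnd (psnd (psnd y))) (pfst z) (psnd z)"
  have "decidable (\<lambda>w. g)" unfolding decidable_def by (rule tc_const)
  then show "decidable3 ?P"
    unfolding conf_matrix_def by (intro decidable3I tc_intros)
  fix x
  obtain R t where x: "x = enc_pair R t" by (rule enc_pair_surj)
  then have "pfst x = enc_trs R" "psnd x = enc_term t" by (simp_all add: enc_pair_def flip: pair_def)
  moreover have "(\<forall>y. \<exists>z. ?P x y z) \<longleftrightarrow>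
      (\<forall>j c y1 y2. \<exists>z1 z2. conf_matrix g (pfst x) (psnd x) j c y1 y2 z1 z2)" (is "?L \<longleftrightarrow> ?R")
  proof
    assume ?L
    show ?R
    proof (intro allI)
      fix j c y1 y2
      show "\<exists>z1 z2. conf_matrix g (pfst x) (psnd x) j c y1 y2 z1 z2"
        using \<open>?L\<close>[rule_format, of "pair j (pair c (pair y1 y2))"] by auto
    qed
  next
    assume ?R
    show ?L
    proof
      fix y
      obtain z1 z2 where "?P x y (pair z1 z2)"
        using \<open>?R\<close> by simp blast
      then show "\<exists>z. ?P x y z" ..
    qed
  qed
  ultimately have "(\<forall>y. \<exists>z. ?P x y z) \<longleftrightarrow> is_trs R \<and> (g \<longrightarrow> ground t) \<and> confluent_on R t"
    by (simp add: conf_matrix_iff)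
  moreover have "x \<in> {enc_pair R t | R t. is_trs R \<and> (g \<longrightarrow> ground t) \<and> confluent_on R t} \<longleftrightarrow>
      is_trs R \<and> (g \<longrightarrow> ground t) \<and> confluent_on R t"
    using x enc_pair_inj by blast
  ultimately show "x \<in> {enc_pair R t | R t. is_trs R \<and> (g \<longrightarrow> ground t) \<and> confluent_on R t} \<longleftrightarrow>
      (\<forall>y. \<exists>z. ?P x y z)" by simp
qed

section \<open>Hardness: a term rewriting system interpreting recursive functions\<close>

text \<open>Symbols below 20 are constructors, the remaining ones head the states of a machine with
  explicit continuations \<open>k\<close>. On states whose arguments are constructor terms only root steps are
  possible, and all of them except those from \<open>Guess\<close> are deterministic.\<close>

abbreviation "tZ \<equiv> Fun 0 []"
abbreviation "tS n \<equiv> Fun 17 [n]"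
abbreviation "tNil \<equiv> Fun 2 []"
abbreviation "tCons x xs \<equiv> Fun 3 [x, xs]"
abbreviation "cZero \<equiv> Fun 4 []"
abbreviation "cSucc \<equiv> Fun 5 []"
abbreviation "cProj n \<equiv> Fun 6 [n]"
abbreviation "cComp g fs \<equiv> Fun 7 [g, fs]"
abbreviation "cPrec f g \<equiv> Fun 8 [f, g]"
abbreviation "cMinim f \<equiv> Fun 9 [f]"
abbreviation "kArg fs xs k \<equiv> Fun 10 [fs, xs, k]"
abbreviation "kCons y k \<equiv> Fun 11 [y, k]"
abbreviation "kComp g k \<equiv> Fun 12 [g, k]"
abbreviation "kPrec g n xs k \<equiv> Fun 13 [g, n, xs, k]"
abbreviation "kMinim f n xs k \<equiv> Fun 14 [f, n, xs, k]"
abbreviation "kSearch p x y z \<equiv> Fun 15 [p, x, y, z]"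
abbreviation "tTrue \<equiv> Fun 16 []"
abbreviation "Eval f xs k \<equiv> Fun 20 [f, xs, k]"
abbreviation "Ret y k \<equiv> Fun 21 [y, k]"
abbreviation "EvalList fs xs k \<equiv> Fun 22 [fs, xs, k]"
abbreviation "RetList ys k \<equiv> Fun 23 [ys, k]"
abbreviation "Guess p x y \<equiv> Fun 24 [p, x, y]"
abbreviation "Search p x y z \<equiv>
  Eval p (tCons x (tCons y (tCons z tNil))) (kSearch p x y z)"

text \<open>Continuations record pending work: \<open>kArg\<close> the functions of a list still to
  be evaluated, \<open>kCons\<close> a result to be put before the later ones, \<open>kComp\<close>
  the outer function, \<open>kPrec\<close> one recursion step, \<open>kMinim\<close> and
  \<open>kSearch\<close> the current candidate. For \<open>kMinim\<close> the result 0 is success,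
  for \<open>kSearch\<close> it is failure.\<close>

definition machine :: "rule list" where
  "machine = (let a = Var 0; b = Var 1; c = Var 2; d = Var 3; e = Var 4 in
   [(Eval cZero a b, Ret tZ b),
    (Eval cSucc (tCons a b) c, Ret (tS a) c),
    (Eval (cProj tZ) (tCons a b) c, Ret a c),
    (Eval (cProj (tS a)) (tCons b c) d, Eval (cProj a) c d),
    (Eval (cComp a b) c d, EvalList b c (kComp a d)),
    (EvalList tNil a b, RetList tNil b),
    (EvalList (tCons a b) c d, Eval a c (kArg b c d)),
    (Ret a (kArg b c d), EvalList b c (kCons a d)),
    (RetList a (kCons b c), RetList (tCons b a) c),
    (RetList a (kComp b c), Eval b a c),
    (Eval (cPrec a b) (tCons tZ c) d, Eval a c d),
    (Eval (cPrec a b) (tCons (tS c) d) e, Eval (cPrec a b) (tCons c d) (kPrec b c d e)),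
    (Ret a (kPrec b c d e), Eval b (tCons c (tCons a d)) e),
    (Eval (cMinim a) b c, Eval a (tCons tZ b) (kMinim a tZ b c)),
    (Ret tZ (kMinim a b c d), Ret b d),
    (Ret (tS e) (kMinim a b c d), Eval a (tCons (tS b) c) (kMinim a (tS b) c d)),
    (Ret tZ (kSearch a b c d), Search a b c (tS d)),
    (Ret (tS e) (kSearch a b c d), tTrue),
    (Guess a b c, Guess a b (tS c)),
    (Guess a b c, tTrue),
    (Guess a b c, Search a b c tZ)])"

abbreviation "step \<equiv> rstep machine"

lemma is_trs_machine: "is_trs machine"
  by (auto simp: is_trs_def machine_def Let_def)

lemma machine_step:
  assumes "i < length machine" "subst ((!) as) (fst (machine ! i)) = s"
    "subst ((!) as) (snd (machine ! i)) = t"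
  shows "step s t"
  using rstep.root[of "fst (machine ! i)" "snd (machine ! i)" machine "(!) as"] assms by simp

lemma machine_steps:
  "step (Eval cZero xs k) (Ret tZ k)"
  "step (Eval cSucc (tCons x xs) k) (Ret (tS x) k)"
  "step (Eval (cProj tZ) (tCons x xs) k) (Ret x k)"
  "step (Eval (cProj (tS n)) (tCons x xs) k) (Eval (cProj n) xs k)"
  "step (Eval (cComp g fs) xs k) (EvalList fs xs (kComp g k))"
  "step (EvalList tNil xs k) (RetList tNil k)"
  "step (EvalList (tCons f fs) xs k) (Eval f xs (kArg fs xs k))"
  "step (Ret y (kArg fs xs k)) (EvalList fs xs (kCons y k))"
  "step (RetList ys (kCons y k)) (RetList (tCons y ys) k)"
  "step (RetList ys (kComp g k)) (Eval g ys k)"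
  "step (Eval (cPrec f g) (tCons tZ xs) k) (Eval f xs k)"
  "step (Eval (cPrec f g) (tCons (tS n) xs) k) (Eval (cPrec f g) (tCons n xs) (kPrec g n xs k))"
  "step (Ret y (kPrec g n xs k)) (Eval g (tCons n (tCons y xs)) k)"
  "step (Eval (cMinim f) xs k) (Eval f (tCons tZ xs) (kMinim f tZ xs k))"
  "step (Ret tZ (kMinim f n xs k)) (Ret n k)"
  "step (Ret (tS m) (kMinim f n xs k)) (Eval f (tCons (tS n) xs) (kMinim f (tS n) xs k))"
  "step (Ret tZ (kSearch p x y z)) (Search p x y (tS z))"
  "step (Ret (tS m) (kSearch p x y z)) tTrue"
  "step (Guess p x y) (Guess p x (tS y))"
  "step (Guess p x y) tTrue"
  "step (Guess p x y) (Search p x y tZ)"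
  subgoal by (rule machine_step[of 0 "[xs, k]"]) (simp_all add: machine_def Let_def)
  subgoal by (rule machine_step[of 1 "[x, xs, k]"]) (simp_all add: machine_def Let_def)
  subgoal by (rule machine_step[of 2 "[x, xs, k]"]) (simp_all add: machine_def Let_def)
  subgoal by (rule machine_step[of 3 "[n, x, xs, k]"]) (simp_all add: machine_def Let_def)
  subgoal by (rule machine_step[of 4 "[g, fs, xs, k]"]) (simp_all add: machine_def Let_def)
  subgoal by (rule machine_step[of 5 "[xs, k]"]) (simp_all add: machine_def Let_def)
  subgoal by (rule machine_step[of 6 "[f, fs, xs, k]"]) (simp_all add: machine_def Let_def)
  subgoal by (rule machine_step[of 7 "[y, fs, xs, k]"]) (simp_all add: machine_def Let_def)
  subgoal by (rule machine_step[of 8 "[ys, y, k]"]) (simp_all add: machine_def Let_def)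
  subgoal by (rule machine_step[of 9 "[ys, g, k]"]) (simp_all add: machine_def Let_def)
  subgoal by (rule machine_step[of 10 "[f, g, xs, k]"]) (simp_all add: machine_def Let_def)
  subgoal by (rule machine_step[of 11 "[f, g, n, xs, k]"]) (simp_all add: machine_def Let_def)
  subgoal by (rule machine_step[of 12 "[y, g, n, xs, k]"]) (simp_all add: machine_def Let_def)
  subgoal by (rule machine_step[of 13 "[f, xs, k]"]) (simp_all add: machine_def Let_def)
  subgoal by (rule machine_step[of 14 "[f, n, xs, k]"]) (simp_all add: machine_def Let_def)
  subgoal by (rule machine_step[of 15 "[f, n, xs, k, m]"]) (simp_all add: machine_def Let_def)
  subgoal by (rule machine_step[of 16 "[p, x, y, z]"]) (simp_all add: machine_def Let_def)
  subgoal by (rule machine_step[of 17 "[p, x, y, z, m]"]) (simp_all add: machine_def Let_def)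
  subgoal by (rule machine_step[of 18 "[p, x, y]"]) (simp_all add: machine_def Let_def)
  subgoal by (rule machine_step[of 19 "[p, x, y]"]) (simp_all add: machine_def Let_def)
  subgoal by (rule machine_step[of 20 "[p, x, y]"]) (simp_all add: machine_def Let_def)
  done

lemmas machine_rsteps = machine_steps[THEN r_into_rtranclp[where r = step]]

section \<open>Simulation of recursive functions\<close>

primrec num :: "nat \<Rightarrow> trm" where
  "num 0 = tZ"
| "num (Suc n) = tS (num n)"

primrec tlist :: "trm list \<Rightarrow> trm" where
  "tlist [] = tNil"
| "tlist (t # ts) = tCons t (tlist ts)"

fun code :: "recf \<Rightarrow> trm" where
  "code Zero = cZero"
| "code Succ = cSucc"
| "code (Proj n) = cProj (num n)"
| "code (Comp g fs) = cComp (code g) (tlist (map code fs))"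
| "code (Prec f g) = cPrec (code f) (code g)"
| "code (Minim f) = cMinim (code f)"

abbreviation "nums xs \<equiv> tlist (map num xs)"

text \<open>Each result waits in a \<open>kCons\<close> continuation until the later ones are known;
  unwinding these restores the order.\<close>

lemma evallist_steps:
  assumes "length ys = length fs"
    and "\<And>i k. i < length fs \<Longrightarrow> step\<^sup>*\<^sup>* (Eval (code (fs ! i)) xs k) (Ret (num (ys ! i)) k)"
  shows "step\<^sup>*\<^sup>* (EvalList (tlist (map code fs)) xs k) (RetList (nums ys) k)"
  using assms
proof (induction ys fs arbitrary: k rule: list_induct2)
  case Nil
  then show ?case by (simp add: machine_rsteps)
next
  case (Cons y ys f fs)
  let ?fs = "tlist (map code fs)"
  have "step\<^sup>*\<^sup>* (EvalList (tlist (map code (f # fs))) xs k) (Eval (code f) xs (kArg ?fs xs k))"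
    by (simp add: machine_rsteps)
  also have "step\<^sup>*\<^sup>* \<dots> (Ret (num y) (kArg ?fs xs k))"
    using Cons.prems[of 0] by simp
  also have "step\<^sup>*\<^sup>* \<dots> (EvalList ?fs xs (kCons (num y) k))"
    by (simp add: machine_rsteps)
  also have "step\<^sup>*\<^sup>* \<dots> (RetList (nums ys) (kCons (num y) k))"
  proof (rule Cons.IH)
    fix i k assume "i < length fs"
    then show "step\<^sup>*\<^sup>* (Eval (code (fs ! i)) xs k) (Ret (num (ys ! i)) k)"
      using Cons.prems[of "Suc i" k] by simp
  qed
  also have "step\<^sup>*\<^sup>* \<dots> (RetList (nums (y # ys)) k)"
    by (simp add: machine_rsteps)
  finally show ?case .
qed

lemma proj_steps:
  "n < length xs \<Longrightarrow> step\<^sup>*\<^sup>* (Eval (cProj (num n)) (nums xs) k) (Ret (num (xs ! n)) k)"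
proof (induction n arbitrary: xs)
  case 0
  then obtain x ys where "xs = x # ys" by (cases xs) auto
  then show ?case by (simp add: machine_rsteps)
next
  case (Suc n)
  then obtain x ys where "xs = x # ys" "n < length ys" by (cases xs) auto
  then show ?case
    using Suc.IH[of ys] converse_rtranclp_into_rtranclp[of step, OF machine_steps(4)] by simp
qed

text \<open>The continuation has to be arbitrary, as subcomputations run under extended
  ones.\<close>

lemma eval_steps:
  "recf_eval p xs y \<Longrightarrow> step\<^sup>*\<^sup>* (Eval (code p) (nums xs) k) (Ret (num y) k)"
proof (induction arbitrary: k rule: recf_eval.induct)
  case (ev_zero xs)
  then show ?case by (simp add: machine_rsteps)
next
  case (ev_succ x xs)
  then show ?case by (simp add: machine_rsteps)
next
  case (ev_proj n xs)
  then show ?case by (simp add: proj_steps)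
next
  case (ev_comp ys fs xs g y)
  have "step\<^sup>*\<^sup>* (Eval (code (Comp g fs)) (nums xs) k)
      (EvalList (tlist (map code fs)) (nums xs) (kComp (code g) k))"
    by (simp add: machine_rsteps)
  also have "step\<^sup>*\<^sup>* \<dots> (RetList (nums ys) (kComp (code g) k))"
    using ev_comp by (intro evallist_steps) auto
  also have "step\<^sup>*\<^sup>* \<dots> (Eval (code g) (nums ys) k)"
    by (simp add: machine_rsteps)
  also have "step\<^sup>*\<^sup>* \<dots> (Ret (num y) k)" by (rule ev_comp.IH)
  finally show ?case .
next
  case (ev_prec0 f xs y g)
  then show ?case
    using converse_rtranclp_into_rtranclp[of step, OF machine_steps(11)] by simp
next
  case (ev_precS f g n xs y z)
  have "step\<^sup>*\<^sup>* (Eval (code (Prec f g)) (nums (Suc n # xs)) k)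
      (Eval (code (Prec f g)) (nums (n # xs)) (kPrec (code g) (num n) (nums xs) k))"
    by (simp add: machine_rsteps)
  also have "step\<^sup>*\<^sup>* \<dots> (Ret (num y) (kPrec (code g) (num n) (nums xs) k))"
    by (rule ev_precS.IH)
  also have "step\<^sup>*\<^sup>* \<dots> (Eval (code g) (nums (n # y # xs)) k)"
    by (simp add: machine_rsteps)
  also have "step\<^sup>*\<^sup>* \<dots> (Ret (num z) k)" by (rule ev_precS.IH)
  finally show ?case .
next
  case (ev_minim f n xs)
  \<comment> \<open>\<open>?S m\<close> tests candidate \<open>m\<close>. The induction runs
    backwards from the least zero \<open>n\<close>: an earlier candidate returns a successor and
    passes to the next one.\<close>
  let ?S = "\<lambda>m. Eval (code f) (nums (m # xs)) (kMinim (code f) (num m) (nums xs) k)"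
  have "step\<^sup>*\<^sup>* (?S m) (Ret (num n) k)" if "m \<le> n" for m
    using that
  proof (induction m rule: inc_induct)
    case base
    have "step\<^sup>*\<^sup>* (?S n) (Ret (num 0) (kMinim (code f) (num n) (nums xs) k))"
      by (rule ev_minim.IH)
    also have "step\<^sup>*\<^sup>* \<dots> (Ret (num n) k)" by (simp add: machine_rsteps)
    finally show ?case .
  next
    case (step m)
    then obtain j where
      "step\<^sup>*\<^sup>* (?S m) (Ret (num (Suc j)) (kMinim (code f) (num m) (nums xs) k))"
      using ev_minim.IH(2) by blast
    also have "step\<^sup>*\<^sup>* \<dots> (?S (Suc m))" by (simp add: machine_rsteps)
    also have "step\<^sup>*\<^sup>* \<dots> (Ret (num n) k)" by (rule step.IH)
    finally show ?case .
  qed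
  from this[of 0] show ?case
    using converse_rtranclp_into_rtranclp[of step, OF machine_steps(14)] by simp
qed

section \<open>Determinism of the machine states\<close>

fun constr :: "trm \<Rightarrow> bool" where
  "constr (Var x) \<longleftrightarrow> False"
| "constr (Fun f ts) \<longleftrightarrow> f < 20 \<and> (\<forall>t\<in>set ts. constr t)"

lemma constr_num: "constr (num n)"
  by (induction n) auto

lemma constr_tlist: "constr (tlist ts) \<longleftrightarrow> (\<forall>t\<in>set ts. constr t)"
  by (induction ts) auto

lemma constr_code: "constr (code p)"
  by (induction p rule: code.induct) (auto simp: constr_num constr_tlist)

lemma constr_ground: "constr t \<Longrightarrow> vars t = {}"
  by (induction t) auto

text \<open>Every left-hand side is headed by a symbol from 20 upwards.\<close>

lemma constr_normal: "step s t \<Longrightarrow> \<not> constr s"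
proof (induction rule: rstep.induct)
  case (root l r \<sigma>)
  then show ?case by (auto simp: machine_def Let_def)
next
  case (ctxt s t i ss f)
  then show ?case using set_update_memI[of i ss s] by auto
qed

text \<open>\<open>Guess\<close>, symbol 24, is excluded because its three rules overlap;
  \<open>tTrue\<close> is included as the final state, so that steps preserve states.\<close>

definition state :: "trm \<Rightarrow> bool" where
  "state s \<longleftrightarrow> s = tTrue \<or> (\<exists>f ss. s = Fun f ss \<and> 20 \<le> f \<and> f < 24 \<and> (\<forall>t\<in>set ss. constr t))"

lemma root_step:
  assumes "step (Fun f ss) t" "\<forall>t\<in>set ss. constr t"
  obtains l r \<sigma> where "(l, r) \<in> set machine" "Fun f ss = subst \<sigma> l" "t = subst \<sigma> r"
  using assms(1)
proof cases
  case (ctxt s t i ss')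
  then show ?thesis using assms(2) constr_normal[of s t] set_update_memI[of i ss' s] by auto
qed (use that in blast)

text \<open>Steps occur at the root only, and left-hand sides with heads 20 to 23 are pairwise not
  unifiable. In the split over pairs of rules only the equal pairs survive.\<close>

lemma state_deterministic:
  assumes "state s" "step s t" "step s u"
  shows "t = u"
proof -
  have "s \<noteq> tTrue" using assms(2) constr_normal[of s t] by auto
  then obtain f ss where s: "s = Fun f ss" "20 \<le> f" "f < 24" "\<forall>t\<in>set ss. constr t"
    using assms(1) by (auto simp: state_def)
  obtain l r \<sigma> where 1: "(l, r) \<in> set machine" "Fun f ss = subst \<sigma> l" "t = subst \<sigma> r"
    using root_step assms(2) s by metis
  obtain l' r' \<tau> where 2: "(l', r') \<in> set machine" "Fun f ss = subst \<tau> l'" "u = subst \<tau> r'"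
    using root_step assms(3) s by metis
  show ?thesis
    using 1 s(2,3) unfolding machine_def Let_def set_simps insert_iff empty_iff prod.inject
    apply (elim disjE conjE FalseE)
    using 2 unfolding machine_def Let_def set_simps insert_iff empty_iff prod.inject
    by (elim disjE conjE FalseE; simp)+
qed

lemma state_step:
  assumes "state s" "step s t"
  shows "state t"
proof -
  have "s \<noteq> tTrue" using assms(2) constr_normal[of s t] by auto
  then obtain f ss where s: "s = Fun f ss" "20 \<le> f" "f < 24" "\<forall>t\<in>set ss. constr t"
    using assms(1) by (auto simp: state_def)
  obtain l r \<sigma> where "(l, r) \<in> set machine" "Fun f ss = subst \<sigma> l" "t = subst \<sigma> r"
    using root_step assms(2) s by metis
  then show ?thesis
    using s(2-4) unfolding machine_def Let_def set_simps insert_iff empty_iff prod.inject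
    by (elim disjE conjE FalseE; simp add: state_def)
qed

lemma Guess_step:
  assumes "step (Guess p x y) t" "constr p" "constr x" "constr y"
  shows "t = Guess p x (tS y) \<or> t = tTrue \<or> t = Search p x y tZ"
proof -
  obtain l r \<sigma> where "(l, r) \<in> set machine" "Guess p x y = subst \<sigma> l" "t = subst \<sigma> r"
    using root_step assms by (metis empty_iff insert_iff list.set)
  then show ?thesis
    unfolding machine_def Let_def set_simps insert_iff empty_iff prod.inject
    by (elim disjE conjE FalseE; simp)
qed

lemma tTrue_normal: "step\<^sup>*\<^sup>* tTrue t \<Longrightarrow> t = tTrue"
  using constr_normal by (force elim: converse_rtranclpE)

text \<open>By determinism all reducts of \<open>s\<close> lie on one path, and this path ends in
  the normal form \<open>tTrue\<close>.\<close>

lemma state_reaches_tTrue: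
  assumes "step\<^sup>*\<^sup>* s t" "state s" "step\<^sup>*\<^sup>* s tTrue"
  shows "step\<^sup>*\<^sup>* t tTrue"
  using assms
proof (induction rule: converse_rtranclp_induct)
  case (step s s')
  then have "s \<noteq> tTrue" using constr_normal[of s s'] by auto
  then obtain s'' where "step s s''" "step\<^sup>*\<^sup>* s'' tTrue"
    using step.prems(2) by (auto elim: converse_rtranclpE)
  with step show ?case using state_deterministic state_step by blast
qed

section \<open>Searching and guessing\<close>

context
  fixes p :: recf and P :: "nat \<Rightarrow> nat \<Rightarrow> nat \<Rightarrow> bool"
  assumes decides: "recf_eval p [x, y, z] (if P x y z then 1 else 0)"
begin

abbreviation "search x y z \<equiv> Search (code p) (num x) (num y) (num z)"

lemma state_search: "state (search x y z)"
  by (simp add: state_def constr_num constr_code)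

lemma search_success: "P x y z \<Longrightarrow> step\<^sup>*\<^sup>* (search x y z) tTrue"
  using eval_steps[OF decides[of x y z], of "kSearch (code p) (num x) (num y) (num z)"]
    machine_steps(18)[of tZ] by (simp add: rtranclp.rtrancl_into_rtrancl)

text \<open>At least one step is asserted, which the proof of divergence relies on.\<close>

lemma search_continue: "\<not> P x y z \<Longrightarrow> step\<^sup>+\<^sup>+ (search x y z) (search x y (Suc z))"
  using eval_steps[OF decides[of x y z], of "kSearch (code p) (num x) (num y) (num z)"]
    machine_steps(17) by (simp add: rtranclp_into_tranclp1)

lemma search_reaches_tTrue:
  assumes "\<exists>z. P x y z"
  shows "step\<^sup>*\<^sup>* (search x y 0) tTrue"
proof -
  obtain n where n: "P x y n" "\<forall>m<n. \<not> P x y m" using assms exists_least_iff[of "P x y"] by blast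
  have "step\<^sup>*\<^sup>* (search x y m) tTrue" if "m \<le> n" for m
    using that
  proof (induction m rule: inc_induct)
    case base show ?case by (rule search_success) (rule n)
  next
    case (step m)
    then show ?case using search_continue[of x y m] n
      by (meson rtranclp_trans tranclp_into_rtranclp)
  qed
  then show ?thesis by blast
qed

text \<open>Induction on the path to \<open>tTrue\<close>. If \<open>s\<close> reached a search, it
  would reach the next search in at least one step; by determinism the successor of \<open>s\<close>
  on the path would reach it too, against the induction hypothesis. The candidate changes on the
  way, hence the generalization over \<open>z\<close>.\<close>

lemma search_diverges:
  assumes "step\<^sup>*\<^sup>* s tTrue" "state s" "\<forall>z. \<not> P x y z"
  shows "\<not> step\<^sup>*\<^sup>* s (search x y z)"
  using assms(1,2)
proof (induction arbitrary: z rule: converse_rtranclp_induct)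
  case base
  then show ?case using tTrue_normal by fastforce
next
  case (step s s')
  have IH: "\<not> step\<^sup>*\<^sup>* s' (search x y z)" for z using step state_step by blast
  show ?case
  proof
    assume "step\<^sup>*\<^sup>* s (search x y z)"
    then have "\<exists>z. step\<^sup>+\<^sup>+ s (search x y z)"
      using search_continue assms(3) by (metis rtranclpD)
    then obtain z s'' where "step s s''" "step\<^sup>*\<^sup>* s'' (search x y z)"
      by (meson tranclpD)
    then show False using IH step state_deterministic by blast
  qed
qed

abbreviation "start x \<equiv> Guess (code p) (num x) tZ"

lemma start_reducts:
  assumes "step\<^sup>*\<^sup>* (start x) t"
  shows "(\<exists>y. t = Guess (code p) (num x) (num y)) \<or> t = tTrue \<or> (\<exists>y. step\<^sup>*\<^sup>* (search x y 0) t)"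
  using assms
proof induction
  case base
  show ?case using num.simps(1) by metis
next
  case (step t u)
  then consider y where "t = Guess (code p) (num x) (num y)" | "t = tTrue"
    | y where "step\<^sup>*\<^sup>* (search x y 0) t" by blast
  then show ?case
  proof cases
    case 1
    with step Guess_step[of "code p" "num x" "num y" u]
    have "u = Guess (code p) (num x) (num (Suc y)) \<or> u = tTrue \<or> u = search x y 0"
      by (simp add: constr_code constr_num)
    then show ?thesis by (metis rtranclp.rtrancl_refl)
  next
    case 2
    then show ?thesis using step tTrue_normal by blast
  next
    case 3
    then show ?thesis using step by (meson rtranclp.rtrancl_into_rtrancl)
  qed
qed

lemma start_reaches_search: "step\<^sup>*\<^sup>* (start x) (search x y 0)"
proof -
  have "step\<^sup>*\<^sup>* (start x) (Guess (code p) (num x) (num y))"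
  proof (induction y)
    case (Suc y)
    then show ?case using machine_steps(19)[of "code p" "num x" "num y"] by simp
  qed simp
  then show ?thesis
    using machine_steps(21)[of "code p" "num x" "num y"] by simp
qed

lemma confluent_on_start: "confluent_on machine (start x) \<longleftrightarrow> (\<forall>y. \<exists>z. P x y z)"
proof
  assume conf: "confluent_on machine (start x)"
  show "\<forall>y. \<exists>z. P x y z"
  proof
    fix y
    \<comment> \<open>The start term also reduces to the normal form \<open>tTrue\<close>, so a
      common reduct can only be \<open>tTrue\<close>.\<close>
    obtain d where "step\<^sup>*\<^sup>* tTrue d" "step\<^sup>*\<^sup>* (search x y 0) d"
      using conf start_reaches_search[of x y] machine_steps(20)
      unfolding confluent_on_def by (meson r_into_rtranclp)
    then have "step\<^sup>*\<^sup>* (search x y 0) tTrue" using tTrue_normal by blast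
    then show "\<exists>z. P x y z"
      \<comment> \<open>Without a witness the initial search, which trivially reaches itself, could
        not reach \<open>tTrue\<close>.\<close>
      using search_diverges[OF _ state_search, of x y 0 x y 0] by blast
  qed
next
  assume *: "\<forall>y. \<exists>z. P x y z"
  have "step\<^sup>*\<^sup>* t tTrue" if "step\<^sup>*\<^sup>* (start x) t" for t
    using start_reducts[OF that]
  proof (elim disjE exE)
    fix y assume "step\<^sup>*\<^sup>* (search x y 0) t"
    then show ?thesis using state_reaches_tTrue state_search search_reaches_tTrue * by blast
  qed (use machine_steps(20) in auto)
  then show "confluent_on machine (start x)"
    unfolding confluent_on_def by blast
qed

end

section \<open>The computable reduction\<close>

lemma tc_enc_num: "total_computable (\<lambda>x. enc_term (num x))"
proof -
  \<comment> \<open>Symbol \<open>f\<close> carries the tag \<open>Suc f\<close>, hence 18 for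
    \<open>tS\<close>.\<close>
  have "rec_nat (enc_term tZ) (\<lambda>_ r. pair 18 (consc r 0)) x = enc_term (num x)" for x
    by (induction x) (simp_all add: pair_def consc_def)
  moreover have "total_computable (\<lambda>x. rec_nat (enc_term tZ) (\<lambda>_ r. pair 18 (consc r 0)) x)"
    by (intro tc_intros)
  ultimately show ?thesis by simp
qed

text \<open>System and program are constants of the reduction; only the numeral depends on
  \<open>x\<close>. The start term is ground, so the same reduction serves both sets.\<close>

lemma Pi02_reduces_to_confluent_on:
  assumes "Pi02 A"
  shows "many_one_reducible A {enc_pair R t | R t. is_trs R \<and> (g \<longrightarrow> ground t) \<and> confluent_on R t}"
proof -
  obtain P p where A: "\<And>x. x \<in> A \<longleftrightarrow> (\<forall>y. \<exists>z. P x y z)"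
    and p: "\<And>x y z. recf_eval p [x, y, z] (if P x y z then 1 else 0)"
    using assms unfolding Pi02_def decidable3_def by blast
  let ?t = "\<lambda>x. Guess (code p) (num x) tZ"
  \<comment> \<open>The tag 25 belongs to \<open>Guess\<close>, symbol 24.\<close>
  have "enc_pair machine (?t x) = pair (enc_trs machine) (pair 25
      (consc (enc_term (code p)) (consc (enc_term (num x)) (list_encode [enc_term tZ]))))" for x
    by (simp add: enc_pair_def pair_def)
  then have "total_computable (\<lambda>x. enc_pair machine (?t x))"
    by (simp only:) (intro tc_intros tc_enc_num)
  moreover have "x \<in> A \<longleftrightarrow>
      enc_pair machine (?t x) \<in> {enc_pair R t | R t. is_trs R \<and> (g \<longrightarrow> ground t) \<and> confluent_on R t}" for x
  proof -
    have "ground (?t x)"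
      by (simp add: ground_def constr_ground constr_code constr_num)
    then show ?thesis
      using confluent_on_start[of p P, OF p] A is_trs_machine enc_pair_inj by blast
  qed
  ultimately show ?thesis unfolding many_one_reducible_def by blast
qed

theorem theorem4:
  shows "Pi02_complete {enc_pair R t | R t. is_trs R \<and> confluent_on R t}
       \<and> Pi02_complete {enc_pair R t | R t. is_trs R \<and> ground t \<and> confluent_on R t}"
proof -
  have "Pi02_complete {enc_pair R t | R t. is_trs R \<and> (g \<longrightarrow> ground t) \<and> confluent_on R t}" for g
    unfolding Pi02_complete_def using Pi02_confluent_on Pi02_reduces_to_confluent_on by blast
  from this[of False] this[of True] show ?thesis by simp
qed

end
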